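(* Let $(P,\rho,\bar\zeta)$ be an Eulerian quasi-graded poset of rank $n+1$ with $\hat0$ and $\hat1$. Then its flag $\bar f$-vector satisfies the generalized Dehn--Sommerville relations: for every subset $S\subseteq\{1,\ldots,n\}$ and all $i,k\in S\cup\{0,n+1\}$ with $i<k$ and $S\cap\{i+1,\ldots,k-1\}=\emptyset$, $$\sum_{j=i}^{k}(-1)^{j}\cdot\bar f_{S\cup\{j\}}=0 ,$$ where $\bar f_{S\cup\{0\}}$ and $\bar f_{S\cup\{n+1\}}$ are understood as $\bar f_S$.
   Context: A quasi-graded poset $(P,\rho,\bar\zeta)$ consists of a finite poset $P$, a function $\rho:P\to\mathbb N$ with $x<y\Rightarrow\rho(x)<\rho(y)$, and a complex-valued function $\bar\zeta$ in the incidence algebra of $P$ with $\bar\zeta(x,x)=1$ for all $x$. Write $\rho(x,y)=\rho(y)-\rho(x)$. It is Eulerian if for all $x\le z$ $$\sum_{x\le y\le z}(-1)^{\rho(x,y)}\,\bar\zeta(x,y)\,\bar\zeta(y,z)=\delta_{x,z}.$$ If $P$ has a minimal element $\hat0$ and a maximal element $\hat1$, normalize $\rho(\hat0)=0$; $P$ has rank $n+1$ ($n\ge0$) if $\rho(\hat1)=n+1$. For $S=\{s_1<\cdots<s_k\}\subseteq\{1,\ldots,n\}$ the flag $\bar f$-vector is $$\bar f_S=\sum_{c}\bar\zeta(x_0,x_1)\,\bar\zeta(x_1,x_2)\cdots\bar\zeta(x_k,x_{k+1}),$$ the sum over all chains $c=\{\hat0=x_0<x_1<\cdots<x_{k+1}=\hat1\}$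 with $\rho(x_i)=s_i$ for $1\le i\le k$. *)

theory Defs
  imports Complex_Main
begin

text \<open>
  The poset is a finite set \<open>P\<close> with the order inherited from its type. An element of the incidence
  algebra is a function on the pairs \<open>x \<le> y\<close> in \<open>P\<close>; here it is a total function \<open>\<zeta>\<close> whose values on
  all other pairs are arbitrary and never used. Likewise only the values of \<open>\<rho>\<close> on \<open>P\<close> matter.
\<close>

locale quasi_graded_poset =
  fixes P :: "'a::order set"
    and \<rho> :: "'a \<Rightarrow> nat"
    and \<zeta> :: "'a \<Rightarrow> 'a \<Rightarrow> complex"
  assumes finite_P: "finite P"
    and rho_strict: "\<And>x y. x \<in> P \<Longrightarrow> y \<in> P \<Longrightarrow> x < y \<Longrightarrow> \<rho> x < \<rho> y"
    and zeta_diag: "\<And>x. x \<in> P \<Longrightarrow> \<zeta> x x = 1"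

text \<open>
  The natural number subtraction \<open>\<rho> y - \<rho> x\<close> never truncates, since \<open>\<rho> x \<le> \<rho> y\<close> whenever \<open>x \<le> y\<close> in \<open>P\<close>.
\<close>

locale eulerian_quasi_graded_poset = quasi_graded_poset +
  assumes eulerian: "\<And>x z. x \<in> P \<Longrightarrow> z \<in> P \<Longrightarrow> x \<le> z \<Longrightarrow>
    (\<Sum>y\<in>{y \<in> P. x \<le> y \<and> y \<le> z}. (-1) ^ (\<rho> y - \<rho> x) * \<zeta> x y * \<zeta> y z)
      = (if x = z then 1 else 0)"

text \<open>
  Least element \<open>b\<close> and greatest element \<open>t\<close>, with the normalization \<open>\<rho> b = 0\<close>, and rank \<open>n + 1\<close>.
\<close>

locale bounded_quasi_graded_poset = quasi_graded_poset P \<rho> \<zeta>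
  for P :: "'a::order set" and \<rho> :: "'a \<Rightarrow> nat" and \<zeta> :: "'a \<Rightarrow> 'a \<Rightarrow> complex" +
  fixes b t :: 'a and n :: nat
  assumes b_in: "b \<in> P" and b_least: "\<And>x. x \<in> P \<Longrightarrow> b \<le> x"
    and t_in: "t \<in> P" and t_greatest: "\<And>x. x \<in> P \<Longrightarrow> x \<le> t"
    and rho_b: "\<rho> b = 0"
    and rho_t: "\<rho> t = n + 1"

text \<open>
  A chain \<open>b = x\<^sub>0 < x\<^sub>1 < \<dots> < x\<^sub>k < x\<^bsub>k+1\<^esub> = t\<close> is given by the list \<open>[x\<^sub>1, \<dots>, x\<^sub>k]\<close> of its
  interior elements.
\<close>

definition flag_chains :: "'a::order set \<Rightarrow> ('a \<Rightarrow> nat) \<Rightarrow> 'a \<Rightarrow> 'a \<Rightarrow> nat set \<Rightarrow> 'a list set" where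
  "flag_chains P \<rho> b t S =
     {xs. set xs \<subseteq> P \<and> sorted_wrt (<) (b # xs @ [t]) \<and> map \<rho> xs = sorted_list_of_set S}"

definition chain_weight :: "('a \<Rightarrow> 'a \<Rightarrow> complex) \<Rightarrow> 'a list \<Rightarrow> complex" where
  "chain_weight \<zeta> ys = (\<Prod>i<length ys - 1. \<zeta> (ys ! i) (ys ! Suc i))"

definition flag_f :: "'a::order set \<Rightarrow> ('a \<Rightarrow> nat) \<Rightarrow> ('a \<Rightarrow> 'a \<Rightarrow> complex) \<Rightarrow> 'a \<Rightarrow> 'a \<Rightarrow> nat set \<Rightarrow> complex" where
  "flag_f P \<rho> \<zeta> b t S = (\<Sum>xs\<in>flag_chains P \<rho> b t S. chain_weight \<zeta> (b # xs @ [t]))"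

end

theory Submission
  imports Defs
begin

text \<open>
  Sum the weights over all weakly increasing sequences with a prescribed list of ranks. Since
  \<open>\<zeta> x x = 1\<close> and a weak relation between elements of equal rank is an equality, repeated ranks
  do not change this sum, so the terms \<open>j = i\<close> and \<open>j = k\<close> of the Dehn--Sommerville relation
  have the same shape as the others. The sum over \<open>j\<close> then runs, for each pair of elements of
  ranks \<open>i\<close> and \<open>k\<close>, over the whole interval between them, where it vanishes by the Eulerian
  condition.
\<close>

lemma chain_weight_single: "chain_weight \<zeta> [x] = 1"
  by (simp add: chain_weight_def)

lemma chain_weight_Cons: "chain_weight \<zeta> (x # y # ys) = \<zeta> x y * chain_weight \<zeta> (y # ys)"
  by (simp add: chain_weight_def prod.lessThan_Suc_shift del: prod.lessThan_Suc)

context quasi_graded_poset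
begin

text \<open>The lower end is a parameter, so that relations can be stated from any element upwards.
  The upper end is not named: in a bounded poset a final rank \<open>n + 1\<close> forces the
  top.\<close>

primrec rank_sum :: "'a \<Rightarrow> nat list \<Rightarrow> complex" where
  "rank_sum x [] = 1"
| "rank_sum x (r # rs) = (\<Sum>y\<in>{y \<in> P. \<rho> y = r \<and> x \<le> y}. \<zeta> x y * rank_sum y rs)"

lemma rho_mono: "x \<in> P \<Longrightarrow> y \<in> P \<Longrightarrow> x \<le> y \<Longrightarrow> \<rho> x \<le> \<rho> y"
  using rho_strict[of x y] by (auto simp: le_less)

lemma eq_of_rho_eq: "x \<in> P \<Longrightarrow> y \<in> P \<Longrightarrow> x \<le> y \<Longrightarrow> \<rho> y = \<rho> x \<Longrightarrow> y = x"
  using rho_strict[of x y] by (auto simp: le_less)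

lemma rank_sum_same_rank:
  assumes "x \<in> P"
  shows "rank_sum x (\<rho> x # rs) = rank_sum x rs"
proof -
  have "{y \<in> P. \<rho> y = \<rho> x \<and> x \<le> y} = {x}"
    using assms eq_of_rho_eq by auto
  then show ?thesis
    by (simp add: assms zeta_diag)
qed

lemma rank_sum_repeat: "rank_sum x (r # r # rs) = rank_sum x (r # rs)"
proof -
  have "rank_sum y (r # rs) = rank_sum y rs" if "y \<in> P" "\<rho> y = r" for y
    using rank_sum_same_rank[of y rs] that by blast
  then show ?thesis
    unfolding rank_sum.simps(2)[of x r] by (intro sum.cong) auto
qed

text \<open>Equal entries of a sorted list are adjacent, so \<open>rank_sum_repeat\<close> removes
  them one at a time.\<close>

lemma rank_sum_remdups: "sorted rs \<Longrightarrow> rank_sum x (remdups rs) = rank_sum x rs"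
proof (induction rs arbitrary: x)
  case (Cons r rs)
  show ?case
  proof (cases "r \<in> set rs")
    case True
    with Cons.prems obtain rs' where "rs = r # rs'"
      by (cases rs) force+
    with Cons True show ?thesis
      using rank_sum_repeat[of x r rs'] by (metis remdups.simps(2) sorted_simps(2))
  qed (use Cons in simp)
qed simp

text \<open>Among sorted lists only the set of ranks matters. This is what later identifies a list
  that repeats some ranks with a flag set.\<close>

lemma rank_sum_set:
  assumes "sorted rs"
  shows "rank_sum x (sorted_list_of_set (set rs)) = rank_sum x rs"
  using assms
  by (simp add: sorted_list_of_set_sort_remdups sorted_sort_id rank_sum_remdups)

lemma linear_combination_rank_sum_Cons:
  "(\<Sum>j\<in>J. c j * rank_sum x (r # l j))
    = (\<Sum>y\<in>{y \<in> P. \<rho> y = r \<and> x \<le> y}. \<zeta> x y * (\<Sum>j\<in>J. c j * rank_sum y (l j)))"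
  by (simp add: sum_distrib_left mult.left_commute sum.swap[of _ _ J])

text \<open>By linearity in the tail, the common prefix can be pulled out of the combination; the
  relation is thus only needed from elements of rank \<open>r\<close> upwards.\<close>

lemma linear_combination_rank_sum_eq_0:
  assumes "\<And>y. y \<in> P \<Longrightarrow> \<rho> y = r \<Longrightarrow> (\<Sum>j\<in>J. c j * rank_sum y (l j)) = 0"
  shows "(\<Sum>j\<in>J. c j * rank_sum x (as @ r # l j)) = 0"
proof (induction as arbitrary: x)
  case Nil
  show ?case
    unfolding append_Nil linear_combination_rank_sum_Cons
    using assms by (intro sum.neutral) auto
next
  case (Cons a as)
  show ?case
    unfolding append_Cons linear_combination_rank_sum_Cons Cons by simp
qed

end

text \<open>Exchanging sums puts the element \<open>z\<close> of rank \<open>k\<close> outermost;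
  for fixed \<open>z\<close> the signed sum over the middle element \<open>w\<close> is the Eulerian
  sum of the interval from \<open>y\<close> to \<open>z\<close>.\<close>

lemma (in eulerian_quasi_graded_poset) eulerian_rank_sum:
  assumes y: "y \<in> P" "\<rho> y = i" and "i < k"
  shows "(\<Sum>j = i..k. (-1) ^ j * rank_sum y (j # k # rs)) = 0"
proof -
  let ?Z = "{z \<in> P. \<rho> z = k}"
  have "(\<Sum>j = i..k. (-1) ^ j * rank_sum y (j # k # rs))
      = (\<Sum>j = i..k. \<Sum>w\<in>{w \<in> {w \<in> P. \<rho> w \<in> {i..k} \<and> y \<le> w}. \<rho> w = j}.
          (-1) ^ \<rho> w * \<zeta> y w * rank_sum w (k # rs))"
    by (auto simp: sum_distrib_left mult.assoc simp del: rank_sum.simps(2)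
          simp: rank_sum.simps(2)[of y] intro!: sum.cong)
  \<comment> \<open>Each \<open>w\<close> has exactly one rank \<open>j\<close>, so the two sums
    merge into one over elements.\<close>
  also have "\<dots> = (\<Sum>w\<in>{w \<in> P. \<rho> w \<in> {i..k} \<and> y \<le> w}.
      (-1) ^ \<rho> w * \<zeta> y w * rank_sum w (k # rs))"
    by (rule sum.group) (auto simp: finite_P)
  also have "\<dots> = (\<Sum>w\<in>{w \<in> P. \<rho> w \<in> {i..k} \<and> y \<le> w}.
      \<Sum>z\<in>{z \<in> ?Z. w \<le> z}. (-1) ^ \<rho> w * \<zeta> y w * \<zeta> w z * rank_sum z rs)"
    by (auto simp: sum_distrib_left mult.assoc intro!: sum.cong)
  also have "\<dots> = (\<Sum>z\<in>?Z. \<Sum>w\<in>{w \<in> {w \<in> P. \<rho> w \<in> {i..k} \<and> y \<le> w}. w \<le> z}.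
      (-1) ^ \<rho> w * \<zeta> y w * \<zeta> w z * rank_sum z rs)"
    by (rule sum.swap_restrict) (auto simp: finite_P)
  also have "\<dots> = 0"
  proof (rule sum.neutral, rule ballI)
    fix z assume z: "z \<in> ?Z"
    let ?I = "{w \<in> P. y \<le> w \<and> w \<le> z}"
    \<comment> \<open>The rank bounds are automatic inside the interval, since \<open>y\<close> has
      rank \<open>i\<close> and \<open>z\<close> has rank \<open>k\<close>.\<close>
    have "{w \<in> {w \<in> P. \<rho> w \<in> {i..k} \<and> y \<le> w}. w \<le> z} = ?I"
      using y z rho_mono by auto
    moreover have "(\<Sum>w\<in>?I. (-1) ^ \<rho> w * \<zeta> y w * \<zeta> w z * rank_sum z rs) = 0"
    proof (cases "y \<le> z")
      case True
      \<comment> \<open>Since \<open>\<rho> y = i\<close>, a constant factor turns the absolute sign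
        into the relative one of the Eulerian condition.\<close>
      have "(-1) ^ \<rho> w = (-1) ^ i * ((-1) ^ (\<rho> w - \<rho> y) :: complex)" if "w \<in> ?I" for w
        using that y rho_mono[of y w] by (simp flip: power_add)
      then have "(\<Sum>w\<in>?I. (-1) ^ \<rho> w * \<zeta> y w * \<zeta> w z * rank_sum z rs)
          = (-1) ^ i * (\<Sum>w\<in>?I. (-1) ^ (\<rho> w - \<rho> y) * \<zeta> y w * \<zeta> w z) * rank_sum z rs"
        by (auto simp: sum_distrib_left sum_distrib_right mult.assoc intro!: sum.cong)
      \<comment> \<open>The ranks \<open>i < k\<close> force \<open>y \<noteq> z\<close>, so the
        Eulerian sum is 0.\<close>
      also have "\<dots> = 0"
        using eulerian[of y z] y z True \<open>i < k\<close> by auto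
      finally show ?thesis .
    next
      case False
      then have "?I = {}" using order_trans by blast
      then show ?thesis by (simp only: sum.empty)
    qed
    ultimately show "(\<Sum>w\<in>{w \<in> {w \<in> P. \<rho> w \<in> {i..k} \<and> y \<le> w}. w \<le> z}.
      (-1) ^ \<rho> w * \<zeta> y w * \<zeta> w z * rank_sum z rs) = 0"
      by simp
  qed
  finally show ?thesis .
qed

context bounded_quasi_graded_poset
begin

lemma rank_top_iff: "x \<in> P \<Longrightarrow> \<rho> x = n + 1 \<longleftrightarrow> x = t"
  using eq_of_rho_eq[of x t] t_in t_greatest rho_t by auto

text \<open>Strictly increasing ranks make the weak relations in \<open>rank_sum\<close> strict, and
  only \<open>t\<close> has rank \<open>n + 1\<close>. The start \<open>x\<close> is general so that
  the induction can peel off the lowest interior element.\<close>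

lemma sum_chains_from_eq_rank_sum:
  assumes "x \<in> P" "sorted_wrt (<) (\<rho> x # l @ [n + 1])"
  shows "(\<Sum>xs\<in>{xs. set xs \<subseteq> P \<and> sorted_wrt (<) (x # xs @ [t]) \<and> map \<rho> xs = l}.
      chain_weight \<zeta> (x # xs @ [t])) = rank_sum x (l @ [n + 1])"
  using assms
proof (induction l arbitrary: x)
  case Nil
  then have "x < t"
    using t_greatest[of x] rho_t by (auto simp: less_le)
  then have "{xs. set xs \<subseteq> P \<and> sorted_wrt (<) (x # xs @ [t]) \<and> map \<rho> xs = []} = {[]}"
    by auto
  moreover have "{y \<in> P. \<rho> y = n + 1 \<and> x \<le> y} = {t}"
    using Nil t_in t_greatest rank_top_iff by blast
  ultimately show ?case
    by (simp add: chain_weight_Cons chain_weight_single)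
next
  case (Cons s l)
  let ?C = "\<lambda>x l. {xs. set xs \<subseteq> P \<and> sorted_wrt (<) (x # xs @ [t]) \<and> map \<rho> xs = l}"
  let ?Y = "{y \<in> P. \<rho> y = s \<and> x \<le> y}"
  have fin: "finite (?C y l)" for y
    by (rule finite_subset[OF _ finite_lists_length_eq[OF finite_P, of "length l"]]) auto
  have less: "x < y" if "y \<in> ?Y" for y
    using that Cons.prems by (auto simp: less_le)
  have trans_less: "sorted_wrt (<) (x # y # ys) \<longleftrightarrow> x < y \<and> sorted_wrt (<) (y # ys)"
    for y ys by auto
  \<comment> \<open>A chain corresponds to its lowest interior element together with the rest;
    gluing them back uses \<open>x < y\<close> and transitivity.\<close>
  have "?C x (s # l) = (\<lambda>(y, ys). y # ys) ` (SIGMA y:?Y. ?C y l)"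
  proof (intro equalityI subsetI)
    fix xs assume xs: "xs \<in> ?C x (s # l)"
    then obtain y ys where "xs = y # ys" by auto
    with xs show "xs \<in> (\<lambda>(y, ys). y # ys) ` (SIGMA y:?Y. ?C y l)"
      by (auto intro!: image_eqI[of _ _ "(y, ys)"])
  next
    fix xs assume "xs \<in> (\<lambda>(y, ys). y # ys) ` (SIGMA y:?Y. ?C y l)"
    then obtain y ys where xs: "xs = y # ys" "y \<in> ?Y" "ys \<in> ?C y l" by auto
    then have "sorted_wrt (<) (x # y # ys @ [t])"
      unfolding trans_less using less by blast
    with xs show "xs \<in> ?C x (s # l)" by simp
  qed
  then have "(\<Sum>xs\<in>?C x (s # l). chain_weight \<zeta> (x # xs @ [t]))
      = (\<Sum>(y, ys)\<in>(SIGMA y:?Y. ?C y l). chain_weight \<zeta> (x # y # ys @ [t]))"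
    by (simp only:) (subst sum.reindex, auto simp: inj_on_def case_prod_beta intro!: sum.cong)
  also have "\<dots> = (\<Sum>y\<in>?Y. \<Sum>ys\<in>?C y l. chain_weight \<zeta> (x # y # ys @ [t]))"
    using finite_P fin by (subst sum.Sigma) auto
  also have "\<dots> = (\<Sum>y\<in>?Y. \<zeta> x y * rank_sum y (l @ [n + 1]))"
  proof (rule sum.cong[OF refl])
    fix y assume "y \<in> ?Y"
    then show "(\<Sum>ys\<in>?C y l. chain_weight \<zeta> (x # y # ys @ [t])) = \<zeta> x y * rank_sum y (l @ [n + 1])"
      using Cons.IH[of y] Cons.prems
      by (simp only: chain_weight_Cons flip: sum_distrib_left) auto
  qed
  finally show ?case by simp
qed

lemma flag_f_eq_rank_sum:
  assumes "sorted rs" "set rs = T \<union> {0, n + 1}" "T \<subseteq> {1..n}"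
  shows "flag_f P \<rho> \<zeta> b t T = rank_sum b rs"
proof -
  let ?l = "sorted_list_of_set T"
  have T: "finite T"
    using assms(3) finite_subset by blast
  have sorted: "sorted_wrt (<) (0 # ?l @ [n + 1])"
    using T assms(3) by (auto simp: sorted_wrt_append)
  have "flag_f P \<rho> \<zeta> b t T = rank_sum b (?l @ [n + 1])"
    unfolding flag_f_def flag_chains_def
    using sum_chains_from_eq_rank_sum[OF b_in, of ?l] sorted rho_b by simp
  \<comment> \<open>Prepending rank 0 only repeats \<open>b\<close>, with weight 1; it lets both
    ends \<open>0\<close> and \<open>n + 1\<close> appear as ordinary ranks.\<close>
  also have "\<dots> = rank_sum b (0 # ?l @ [n + 1])"
    using rank_sum_same_rank[OF b_in] rho_b by metis
  also have "\<dots> = rank_sum b (sorted_list_of_set (set (0 # ?l @ [n + 1])))"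
    using sorted by (intro rank_sum_set[symmetric] strict_sorted_imp_sorted)
  also have "set (0 # ?l @ [n + 1]) = set rs"
    using T assms(2) by auto
  finally show ?thesis
    using rank_sum_set[OF assms(1)] by simp
qed

end

theorem theorem4p3:
  fixes P :: "'a::order set"
    and \<rho> :: "'a \<Rightarrow> nat"
    and \<zeta> :: "'a \<Rightarrow> 'a \<Rightarrow> complex"
    and b t :: 'a
    and n i k :: nat
    and S :: "nat set"
  assumes "eulerian_quasi_graded_poset P \<rho> \<zeta>"
    and "bounded_quasi_graded_poset P \<rho> \<zeta> b t n"
    and "S \<subseteq> {1..n}"
    and "i \<in> S \<union> {0, n + 1}" and "k \<in> S \<union> {0, n + 1}"
    and "i < k"
    and "S \<inter> {i + 1..k - 1} = {}"
  shows "(\<Sum>j = i..k. (-1) ^ j * flag_f P \<rho> \<zeta> b t ((S \<union> {j}) - {0, n + 1})) = 0"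
proof -
  interpret eulerian_quasi_graded_poset P \<rho> \<zeta> by fact
  interpret bounded_quasi_graded_poset P \<rho> \<zeta> b t n by fact
  let ?S = "S \<union> {0, n + 1}"
  \<comment> \<open>The ranks outside \<open>{i..k}\<close> are common to all terms; adjoining
    \<open>0\<close> and \<open>n + 1\<close> to \<open>S\<close> treats the boundary values of
    \<open>i\<close> and \<open>k\<close> uniformly.\<close>
  define as where "as = sorted_list_of_set (?S \<inter> {..<i})"
  define bs where "bs = sorted_list_of_set (?S \<inter> {k<..})"
  have fin: "finite ?S"
    using assms(3) finite_subset by blast
  have as: "set as = ?S \<inter> {..<i}" "sorted as"
    and bs: "set bs = ?S \<inter> {k<..}" "sorted bs"
    using fin by (simp_all add: as_def bs_def)
  have k: "k \<le> n + 1"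
    using assms(3,5) by auto
  have gap: "x \<le> i \<or> k \<le> x" if "x \<in> ?S" for x
  proof (rule ccontr)
    assume "\<not> (x \<le> i \<or> k \<le> x)"
    then have "x \<in> {i + 1..k - 1}" "x \<noteq> 0" "x \<noteq> n + 1"
      using k by auto
    then show False
      using that assms(7) by blast
  qed
  \<comment> \<open>Listing \<open>i\<close> and \<open>k\<close> besides \<open>j\<close> gives
    every term the same shape; for \<open>j = i\<close> or \<open>j = k\<close> a rank is merely
    repeated.\<close>
  have "flag_f P \<rho> \<zeta> b t ((S \<union> {j}) - {0, n + 1}) = rank_sum b (as @ i # j # k # bs)"
    if j: "j \<in> {i..k}" for j
  proof (rule flag_f_eq_rank_sum)
    show "sorted (as @ i # j # k # bs)"
      using as bs j by (auto simp: sorted_append)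
    have "set (as @ i # j # k # bs) = ?S \<inter> {..<i} \<union> ?S \<inter> {k<..} \<union> {i, k, j}"
      using as bs by auto
    also have "\<dots> = ?S \<union> {j}"
    proof (intro equalityI subsetI)
      fix x assume "x \<in> ?S \<union> {j}"
      then show "x \<in> ?S \<inter> {..<i} \<union> ?S \<inter> {k<..} \<union> {i, k, j}"
        using gap[of x] by (cases "x = i \<or> x = k \<or> x = j") auto
    qed (use assms(4,5) in blast)
    finally show "set (as @ i # j # k # bs) = (S \<union> {j}) - {0, n + 1} \<union> {0, n + 1}"
      by blast
    show "(S \<union> {j}) - {0, n + 1} \<subseteq> {1..n}"
      using assms(3) j k by auto
  qed
  then have "(\<Sum>j = i..k. (-1) ^ j * flag_f P \<rho> \<zeta> b t ((S \<union> {j}) - {0, n + 1}))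
      = (\<Sum>j = i..k. (-1) ^ j * rank_sum b (as @ i # j # k # bs))"
    by (intro sum.cong) auto
  \<comment> \<open>The common prefix is \<open>as\<close> followed by the fixed rank
    \<open>i\<close>, above which the local relation applies.\<close>
  also have "\<dots> = 0"
    using assms(6) by (intro linear_combination_rank_sum_eq_0 eulerian_rank_sum)
  finally show ?thesis .
qed

end
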